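(* Let $X$ be a connected coarse space, let $Y$ be a uniform space, and let $\varphi\colon X\to Y$ be a map. The following are equivalent: (1) $\varphi$ is slowly oscillating; (2) for any $x,y\in\mathrm{INF}(X)$, if $x\sim_{X}y$, then ${}^{\ast}\varphi(x)\approx_{Y}{}^{\ast}\varphi(y)$.
   Context: Nonstandard setting: fix a transitive universe $\mathbb{U}$ (the standard universe) satisfying sufficiently many axioms of ZFC and containing all standard objects considered, and a $|\mathbb{U}|^{+}$-saturated enlargement $\ast\colon\mathbb{U}\hookrightarrow{}^{\ast}\mathbb{U}$ (so transfer, i.e. elementary extension, and saturation are available). A standard set $X$ is regarded as a subset of ${}^{\ast}X$ by identifying $x$ with ${}^{\ast}x$. A coarse structure on a set $X$ is a family $\mathcal{C}_{X}\subseteq\mathcal{P}(X\times X)$ which contains the diagonal $\Delta_{X}$ and is closed under taking subsets, finite unions, compositions $E\circ F$ of relations, and inverses $E^{-1}$. The pair $(X,\mathcal{C}_{X})$ is a coarse space. Its finite closeness relation is the relation ${\sim_{X}}=\bigcup_{E\in\mathcal{C}_{X}}{}^{\ast}E$ on ${}^{\ast}X$. A subset $B\subseteq X$ is bounded if $B\times B\in\mathcal{C}_{X}$; $\mathcal{B}_{X}$ denotes the family of all bounded sets (the induced prebornology). The coarse space $X$ is connected if every finite subset of $X$ is bounded. For $x\in X$ the galaxy of $x$ is $G_{X}(x)=\bigcup\{{}^{\ast}B: x\in B\in\mathcal{B}_{X}\}\subseteq{}^{\ast}X$. A point of ${}^{\ast}X$ is finite if it belongs to $G_{X}(x')$ for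 some $x'\in X$, and infinite otherwise; $\mathrm{INF}(X)$ is the set of infinite points. For a uniform space $(Y,\mathcal{U}_{Y})$, the infinite closeness relation on ${}^{\ast}Y$ is ${\approx_{Y}}=\bigcap_{U\in\mathcal{U}_{Y}}{}^{\ast}U$. A map $\varphi\colon X\to Y$ from a connected coarse space to a uniform space is slowly oscillating if for every $E\in\mathcal{C}_{X}$ and every $U\in\mathcal{U}_{Y}$ there is a $B\in\mathcal{B}_{X}$ such that $(\varphi(x),\varphi(y))\in U$ for all $(x,y)\in E\setminus(B\times B)$. *)

theory Defs
  imports Complex_Main
begin

unbundle cardinal_syntax

section \<open>Coarse spaces, uniform spaces and slowly oscillating maps\<close>

definition coarse_structure :: "'a set \<Rightarrow> ('a \<times> 'a) set set \<Rightarrow> bool" where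
  "coarse_structure X \<C> \<longleftrightarrow>
     \<C> \<subseteq> Pow (X \<times> X) \<and>
     Id_on X \<in> \<C> \<and>
     (\<forall>E\<in>\<C>. \<forall>F. F \<subseteq> E \<longrightarrow> F \<in> \<C>) \<and>
     (\<forall>E\<in>\<C>. \<forall>F\<in>\<C>. E \<union> F \<in> \<C>) \<and>
     (\<forall>E\<in>\<C>. \<forall>F\<in>\<C>. E O F \<in> \<C>) \<and>
     (\<forall>E\<in>\<C>. E\<inverse> \<in> \<C>)"

definition bounded_sets :: "'a set \<Rightarrow> ('a \<times> 'a) set set \<Rightarrow> 'a set set" where
  "bounded_sets X \<C> = {B. B \<subseteq> X \<and> B \<times> B \<in> \<C>}"

definition coarsely_connected :: "'a set \<Rightarrow> ('a \<times> 'a) set set \<Rightarrow> bool" where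
  "coarsely_connected X \<C> \<longleftrightarrow> (\<forall>F. F \<subseteq> X \<and> finite F \<longrightarrow> F \<in> bounded_sets X \<C>)"

text \<open>
  Uniform structures are given by their entourages on a carrier set, since the points of the
  spaces below are the elements of a set of the universe rather than of a type (and the empty
  space is allowed).  For a type of class \<^class>\<open>uniform_space\<close> this is the library notion;
  see \<open>uniform_structure_uniformity\<close>.
\<close>

definition uniform_structure :: "'a set \<Rightarrow> ('a \<times> 'a) set set \<Rightarrow> bool" where
  "uniform_structure Y \<U> \<longleftrightarrow>
     \<U> \<subseteq> Pow (Y \<times> Y) \<and>
     Y \<times> Y \<in> \<U> \<and>
     (\<forall>U\<in>\<U>. \<forall>V. U \<subseteq> V \<and> V \<subseteq> Y \<times> Y \<longrightarrow> V \<in> \<U>) \<and>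
     (\<forall>U\<in>\<U>. \<forall>V\<in>\<U>. U \<inter> V \<in> \<U>) \<and>
     (\<forall>U\<in>\<U>. Id_on Y \<subseteq> U) \<and>
     (\<forall>U\<in>\<U>. U\<inverse> \<in> \<U>) \<and>
     (\<forall>U\<in>\<U>. \<exists>V\<in>\<U>. V O V \<subseteq> U)"

lemma uniform_structure_uniformity:
  "uniform_structure UNIV {U :: ('a::uniform_space \<times> 'a) set. \<forall>\<^sub>F p in uniformity. p \<in> U}"
proof -
  have sym: "\<forall>\<^sub>F p in uniformity. p \<in> U\<inverse>"
    if "\<forall>\<^sub>F p in uniformity. p \<in> U" for U :: "('a \<times> 'a) set"
    using uniformity_sym[OF that] by (simp add: case_prod_unfold converse_unfold)
  have half: "\<exists>V. (\<forall>\<^sub>F p in uniformity. p \<in> V) \<and> V O V \<subseteq> U"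
    if U: "\<forall>\<^sub>F p in uniformity. p \<in> U" for U :: "('a \<times> 'a) set"
  proof -
    obtain D where "eventually D uniformity"
      and "\<And>x y z. D (x, y) \<Longrightarrow> D (y, z) \<Longrightarrow> (x, z) \<in> U"
      using uniformity_trans[OF U] by blast
    then show ?thesis by (intro exI[of _ "Collect D"]) auto
  qed
  show ?thesis
    unfolding uniform_structure_def
    using sym half
    by (auto intro: eventually_conj uniformity_refl elim: eventually_mono)
qed

definition slowly_oscillating ::
  "'a set \<Rightarrow> ('a \<times> 'a) set set \<Rightarrow> ('b \<times> 'b) set set \<Rightarrow> ('a \<Rightarrow> 'b) \<Rightarrow> bool" where
  "slowly_oscillating X \<C> \<U> \<phi> \<longleftrightarrow>
     (\<forall>E\<in>\<C>. \<forall>U\<in>\<U>. \<exists>B\<in>bounded_sets X \<C>. \<forall>(x, y) \<in> E - B \<times> B. (\<phi> x, \<phi> y) \<in> U)"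


section \<open>First-order logic of set theory\<close>

datatype fm = Mem nat nat | Eq nat nat | Neg fm | Conj fm fm | All nat fm

primrec sat :: "('u \<Rightarrow> 'u \<Rightarrow> bool) \<Rightarrow> (nat \<Rightarrow> 'u) \<Rightarrow> fm \<Rightarrow> bool" where
  "sat m \<rho> (Mem i j) = m (\<rho> i) (\<rho> j)"
| "sat m \<rho> (Eq i j) = (\<rho> i = \<rho> j)"
| "sat m \<rho> (Neg \<psi>) = (\<not> sat m \<rho> \<psi>)"
| "sat m \<rho> (Conj \<psi> \<chi>) = (sat m \<rho> \<psi> \<and> sat m \<rho> \<chi>)"
| "sat m \<rho> (All i \<psi>) = (\<forall>a. sat m (\<rho>(i := a)) \<psi>)"


section \<open>Sets, ordered pairs, relations and functions inside a membership structure\<close>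

definition ext :: "('u \<Rightarrow> 'u \<Rightarrow> bool) \<Rightarrow> 'u \<Rightarrow> 'u set" where
  "ext m a = {x. m x a}"

text \<open>The element \<open>p\<close> is the Kuratowski pair of \<open>x\<close> and \<open>y\<close>.\<close>

definition is_pair :: "('u \<Rightarrow> 'u \<Rightarrow> bool) \<Rightarrow> 'u \<Rightarrow> 'u \<Rightarrow> 'u \<Rightarrow> bool" where
  "is_pair m p x y \<longleftrightarrow> (\<exists>s t. ext m s = {x} \<and> ext m t = {x, y} \<and> ext m p = {s, t})"

definition rel :: "('u \<Rightarrow> 'u \<Rightarrow> bool) \<Rightarrow> 'u \<Rightarrow> ('u \<times> 'u) set" where
  "rel m r = {(x, y). \<exists>p\<in>ext m r. is_pair m p x y}"

definition is_rel :: "('u \<Rightarrow> 'u \<Rightarrow> bool) \<Rightarrow> 'u \<Rightarrow> bool" where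
  "is_rel m r \<longleftrightarrow> (\<forall>p\<in>ext m r. \<exists>x y. is_pair m p x y)"

text \<open>The family of relations coded by a set of the structure.\<close>

definition rels :: "('u \<Rightarrow> 'u \<Rightarrow> bool) \<Rightarrow> 'u \<Rightarrow> ('u \<times> 'u) set set" where
  "rels m c = rel m ` ext m c"

definition is_fun :: "('u \<Rightarrow> 'u \<Rightarrow> bool) \<Rightarrow> 'u \<Rightarrow> 'u \<Rightarrow> 'u \<Rightarrow> bool" where
  "is_fun m f X Y \<longleftrightarrow>
     is_rel m f \<and> rel m f \<subseteq> ext m X \<times> ext m Y \<and> (\<forall>x\<in>ext m X. \<exists>!y. (x, y) \<in> rel m f)"

definition fun_app :: "('u \<Rightarrow> 'u \<Rightarrow> bool) \<Rightarrow> 'u \<Rightarrow> 'u \<Rightarrow> 'u" where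
  "fun_app m f x = (THE y. (x, y) \<in> rel m f)"

definition connected_coarse_space :: "('u \<Rightarrow> 'u \<Rightarrow> bool) \<Rightarrow> 'u \<Rightarrow> 'u \<Rightarrow> bool" where
  "connected_coarse_space m X C \<longleftrightarrow>
     (\<forall>e\<in>ext m C. is_rel m e) \<and>
     coarse_structure (ext m X) (rels m C) \<and> coarsely_connected (ext m X) (rels m C)"

definition is_uniform_space :: "('u \<Rightarrow> 'u \<Rightarrow> bool) \<Rightarrow> 'u \<Rightarrow> 'u \<Rightarrow> bool" where
  "is_uniform_space m Y V \<longleftrightarrow>
     (\<forall>v\<in>ext m V. is_rel m v) \<and> uniform_structure (ext m Y) (rels m V)"


section \<open>The standard universe and its saturated enlargement\<close>

text \<open>
  A transitive universe is represented, up to its Mostowski isomorphism, by a type with an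
  extensional well-founded membership relation.  The axioms below are the fragment of ZFC
  that is required of it; a universe satisfying further axioms (power set, infinity,
  replacement, choice) is a particular case.
\<close>

locale transitive_universe =
  fixes mem :: "'u \<Rightarrow> 'u \<Rightarrow> bool"
  assumes extensionality: "ext mem a = ext mem b \<Longrightarrow> a = b"
    and well_founded: "wfp mem"
    and pairing: "\<exists>c. ext mem c = {a, b}"
    and union: "\<exists>b. ext mem b = (\<Union>c\<in>ext mem a. ext mem c)"
    and separation: "\<exists>b. ext mem b = {x \<in> ext mem a. sat mem (\<rho>(i := x)) \<psi>}"

text \<open>
  The internal universe is an arbitrary, in general ill-founded, membership structure; its
  internal sets are the sets \<open>ext imem a\<close>.  Saturation is the usual property of families of
  fewer than \<open>|\<bbbU>|\<^sup>+\<close> internal sets.  It entails the enlargement property, the case of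
  a family of sets of the form \<open>ext imem (star a)\<close>.
\<close>

locale saturated_enlargement = transitive_universe mem
  for mem :: "'u \<Rightarrow> 'u \<Rightarrow> bool" +
  fixes imem :: "'s \<Rightarrow> 's \<Rightarrow> bool"
    and star :: "'u \<Rightarrow> 's"
  assumes transfer: "sat mem \<rho> \<psi> \<longleftrightarrow> sat imem (\<lambda>i. star (\<rho> i)) \<psi>"
    and saturation:
      "\<lbrakk> |A| <o cardSuc |UNIV :: 'u set|;
         \<And>F. finite F \<Longrightarrow> F \<subseteq> A \<Longrightarrow> (\<Inter>a\<in>F. ext imem a) \<noteq> {} \<rbrakk>
       \<Longrightarrow> (\<Inter>a\<in>A. ext imem a) \<noteq> {}"


section \<open>Nonstandard notions\<close>

text \<open>Below, \<open>X\<close>, \<open>C\<close> and \<open>V\<close> are elements of the standard universe, and a standard set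
  or relation \<open>a\<close> has as its nonstandard extension the set \<open>ext imem (star a)\<close>,
  respectively the relation \<open>rel imem (star a)\<close>.  In \<open>galaxy\<close>, the variable \<open>b\<close> ranges over
  the elements of the universe coding bounded sets; every bounded set \<open>B\<close> has such a code,
  by separation from \<open>X\<close> with \<open>B \<times> B\<close> as a parameter.\<close>

definition finitely_close ::
  "('u \<Rightarrow> 'u \<Rightarrow> bool) \<Rightarrow> ('s \<Rightarrow> 's \<Rightarrow> bool) \<Rightarrow> ('u \<Rightarrow> 's) \<Rightarrow> 'u \<Rightarrow> ('s \<times> 's) set" where
  "finitely_close mem imem star C = (\<Union>e\<in>ext mem C. rel imem (star e))"

definition infinitely_close ::
  "('u \<Rightarrow> 'u \<Rightarrow> bool) \<Rightarrow> ('s \<Rightarrow> 's \<Rightarrow> bool) \<Rightarrow> ('u \<Rightarrow> 's) \<Rightarrow> 'u \<Rightarrow> ('s \<times> 's) set" where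
  "infinitely_close mem imem star V = (\<Inter>v\<in>ext mem V. rel imem (star v))"

definition galaxy ::
  "('u \<Rightarrow> 'u \<Rightarrow> bool) \<Rightarrow> ('s \<Rightarrow> 's \<Rightarrow> bool) \<Rightarrow> ('u \<Rightarrow> 's) \<Rightarrow> 'u \<Rightarrow> 'u \<Rightarrow> 'u \<Rightarrow> 's set" where
  "galaxy mem imem star X C x =
     \<Union>{ext imem (star b) | b.
          x \<in> ext mem b \<and> ext mem b \<in> bounded_sets (ext mem X) (rels mem C)}"

definition INF_points ::
  "('u \<Rightarrow> 'u \<Rightarrow> bool) \<Rightarrow> ('s \<Rightarrow> 's \<Rightarrow> bool) \<Rightarrow> ('u \<Rightarrow> 's) \<Rightarrow> 'u \<Rightarrow> 'u \<Rightarrow> 's set" where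
  "INF_points mem imem star X C =
     ext imem (star X) - (\<Union>x\<in>ext mem X. galaxy mem imem star X C x)"

end

theory Submission
  imports Defs
begin

text \<open>
  Call a pair \<open>(x, y)\<close> in a controlled relation \<open>E\<close> a jump off \<open>B\<close>, for an entourage \<open>U\<close>, if
  both points lie outside \<open>B\<close> and their images are not \<open>U\<close>-close.  Both sides of the
  equivalence say something about jumps, for each \<open>E\<close> and \<open>U\<close> separately.

  Slow oscillation says that some bounded \<open>B\<close> admits no jump off \<open>B\<close>.  Its definition only
  exempts the pairs with both ends in \<open>B\<close>, whereas a jump has both ends outside \<open>B\<close>; but the
  remaining pairs of \<open>E\<close>, with one end in \<open>B\<close>, have both ends in the \<open>E\<close>-neighbourhood of \<open>B\<close>,
  which is again bounded (\<open>avoid_square_iff_avoid_ends\<close>).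

  On the nonstandard side, an infinite point is a point of \<open>*X\<close> outside \<open>*B\<close> for every standard
  bounded \<open>B\<close> (\<open>INF_points_iff\<close>).  So condition (2) fails for \<open>E\<close> and \<open>U\<close> exactly if some single
  pair in \<open>*E\<close> is a jump off all of the sets \<open>*B\<close> simultaneously.

  Transfer and saturation connect the two (\<open>universal_jump_iff\<close>).  If a pair in \<open>*E\<close> is a jump off
  every \<open>*B\<close>, then transfer for each fixed \<open>B\<close> yields a jump off \<open>B\<close> in \<open>E\<close>.  Conversely, if there
  are jumps off every bounded set, then, as finite unions of bounded sets are bounded (here
  connectedness enters), finitely many of the sets of jumps have a common element, and
  saturation yields an element common to all their extensions.
\<close>

section \<open>Bounded sets of a coarse space\<close>

lemma coarse_structureD:
  assumes "coarse_structure X \<C>"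
  shows "Id_on X \<in> \<C>" "E \<in> \<C> \<Longrightarrow> E \<subseteq> X \<times> X" "E \<in> \<C> \<Longrightarrow> F \<subseteq> E \<Longrightarrow> F \<in> \<C>"
    "E \<in> \<C> \<Longrightarrow> F \<in> \<C> \<Longrightarrow> E \<union> F \<in> \<C>" "E \<in> \<C> \<Longrightarrow> F \<in> \<C> \<Longrightarrow> E O F \<in> \<C>"
    "E \<in> \<C> \<Longrightarrow> E\<inverse> \<in> \<C>"
proof -
  note C = assms[unfolded coarse_structure_def]
  show "Id_on X \<in> \<C>" using C by (elim conjE)
  show "E \<subseteq> X \<times> X" if "E \<in> \<C>" using C that by (elim conjE) (metis PowD subsetD)
  show "F \<in> \<C>" if "E \<in> \<C>" "F \<subseteq> E" using C that by (elim conjE) metis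
  show "E \<union> F \<in> \<C>" if "E \<in> \<C>" "F \<in> \<C>" using C that by (elim conjE) metis
  show "E O F \<in> \<C>" if "E \<in> \<C>" "F \<in> \<C>" using C that by (elim conjE) metis
  show "E\<inverse> \<in> \<C>" if "E \<in> \<C>" using C that by (elim conjE) metis
qed

text \<open>Two points of the image are linked by going back into \<open>B\<close> along \<open>E\<inverse>\<close>, across \<open>B\<close>, and out along
  \<open>E\<close>.\<close>

lemma bounded_Image:
  assumes "coarse_structure X \<C>" "E \<in> \<C>" "B \<in> bounded_sets X \<C>"
  shows "E `` B \<in> bounded_sets X \<C>"
proof -
  note C = coarse_structureD[OF assms(1)]
  have "B \<times> B \<in> \<C>" using assms(3) unfolding bounded_sets_def by simp
  then have "E\<inverse> O (B \<times> B) O E \<in> \<C>" using C(5,6) assms(2) by simp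
  moreover have "(E `` B) \<times> (E `` B) \<subseteq> E\<inverse> O (B \<times> B) O E" by blast
  ultimately have "(E `` B) \<times> (E `` B) \<in> \<C>" by (rule C(3))
  then show ?thesis
    using C(2)[OF assms(2)] unfolding bounded_sets_def by blast
qed

text \<open>By connectedness one point of \<open>A\<close> and one point of \<open>B\<close> form a bounded set, and the union is
  the image of that set under \<open>(A \<times> A) \<union> (B \<times> B)\<close>.\<close>

lemma bounded_Un:
  assumes "coarse_structure X \<C>" "coarsely_connected X \<C>"
    and "A \<in> bounded_sets X \<C>" "B \<in> bounded_sets X \<C>"
  shows "A \<union> B \<in> bounded_sets X \<C>"
proof (cases "A = {} \<or> B = {}")
  case True
  then show ?thesis using assms by auto
next
  case False
  then obtain a b where ab: "a \<in> A" "b \<in> B" by blast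
  have "A \<times> A \<union> B \<times> B \<in> \<C>"
    using coarse_structureD(4)[OF assms(1)] assms(3,4) unfolding bounded_sets_def by blast
  moreover have "{a, b} \<in> bounded_sets X \<C>"
  proof -
    have "{a, b} \<subseteq> X" using assms(3,4) ab unfolding bounded_sets_def by blast
    then show ?thesis using assms(2) unfolding coarsely_connected_def by blast
  qed
  ultimately have "(A \<times> A \<union> B \<times> B) `` {a, b} \<in> bounded_sets X \<C>"
    using assms(1) bounded_Image by blast
  moreover have "(A \<times> A \<union> B \<times> B) `` {a, b} = A \<union> B" using ab by blast
  ultimately show ?thesis by simp
qed

lemma bounded_Union:
  assumes "coarse_structure X \<C>" "coarsely_connected X \<C>"
    and "finite \<F>" "\<F> \<subseteq> bounded_sets X \<C>"
  shows "\<Union>\<F> \<in> bounded_sets X \<C>"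
  using assms(3,4)
proof (induction \<F>)
  case empty
  then show ?case using assms(2) unfolding coarsely_connected_def by simp
next
  case (insert B \<F>)
  then show ?case using bounded_Un[OF assms(1,2), of B "\<Union>\<F>"] by simp
qed

text \<open>A pair of \<open>E\<close> with one end in \<open>B\<close> has both ends in the symmetric \<open>E\<close>-neighbourhood of \<open>B\<close>.
  Avoiding the square of that neighbourhood therefore keeps both ends out of \<open>B\<close>.\<close>

lemma avoid_square_iff_avoid_ends:
  assumes "coarse_structure X \<C>" "E \<in> \<C>"
  shows "(\<exists>B\<in>bounded_sets X \<C>. \<forall>(x, y)\<in>E - B \<times> B. P x y) \<longleftrightarrow>
    (\<exists>B\<in>bounded_sets X \<C>. \<forall>(x, y)\<in>E. x \<notin> B \<longrightarrow> y \<notin> B \<longrightarrow> P x y)"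
    (is "?L \<longleftrightarrow> ?R")
proof
  assume ?L
  then show ?R by blast
next
  assume ?R
  then obtain B where B: "B \<in> bounded_sets X \<C>"
    and P: "\<And>x y. (x, y) \<in> E \<Longrightarrow> x \<notin> B \<Longrightarrow> y \<notin> B \<Longrightarrow> P x y" by blast
  define D where "D = E \<union> E\<inverse> \<union> Id_on X"
  have "D \<in> \<C>"
    unfolding D_def using coarse_structureD[OF assms(1)] assms(2) by simp
  then have N: "D `` B \<in> bounded_sets X \<C>"
    using bounded_Image assms(1) B by blast
  have "B \<subseteq> X" using B unfolding bounded_sets_def by blast
  then have "P x y" if "(x, y) \<in> E - (D `` B) \<times> (D `` B)" for x y
    using that P[of x y] unfolding D_def by blast
  then show ?L using N by blast
qed


section \<open>Pairs, relations and functions as formulas\<close>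

lemma is_pair_inj:
  assumes "is_pair m p x y" "is_pair m p x' y'"
  shows "x = x'" "y = y'"
proof -
  obtain s t where st: "ext m s = {x}" "ext m t = {x, y}" "ext m p = {s, t}"
    using assms(1) unfolding is_pair_def by blast
  obtain s' t' where st': "ext m s' = {x'}" "ext m t' = {x', y'}" "ext m p = {s', t'}"
    using assms(2) unfolding is_pair_def by blast
  have "s = s' \<and> t = t' \<or> s = t' \<and> t = s'"
    using st(3) st'(3) by (auto simp: doubleton_eq_iff)
  then have "x = x' \<and> y = y'"
    using st(1,2) st'(1,2) by (elim disjE) (auto simp: doubleton_eq_iff)
  then show "x = x'" "y = y'" by simp_all
qed

lemma fun_app_eq_iff:
  assumes "\<exists>!y. (x, y) \<in> rel m f"
  shows "(x, y) \<in> rel m f \<longleftrightarrow> fun_app m f x = y"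
  using theI'[OF assms] assms unfolding fun_app_def by blast

definition Exi :: "nat \<Rightarrow> fm \<Rightarrow> fm" where
  "Exi i \<psi> = Neg (All i (Neg \<psi>))"

definition Iff :: "fm \<Rightarrow> fm \<Rightarrow> fm" where
  "Iff \<psi> \<chi> = Conj (Neg (Conj \<psi> (Neg \<chi>))) (Neg (Conj \<chi> (Neg \<psi>)))"

definition Disj :: "fm \<Rightarrow> fm \<Rightarrow> fm" where
  "Disj \<psi> \<chi> = Neg (Conj (Neg \<psi>) (Neg \<chi>))"

lemma sat_connectives [simp]:
  "sat m \<rho> (Exi i \<psi>) \<longleftrightarrow> (\<exists>a. sat m (\<rho>(i := a)) \<psi>)"
  "sat m \<rho> (Iff \<psi> \<chi>) \<longleftrightarrow> (sat m \<rho> \<psi> \<longleftrightarrow> sat m \<rho> \<chi>)"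
  "sat m \<rho> (Disj \<psi> \<chi>) \<longleftrightarrow> sat m \<rho> \<psi> \<or> sat m \<rho> \<chi>"
  unfolding Exi_def Iff_def Disj_def by auto

text \<open>Variables are named, so bound ones must not capture the arguments: the variables below \<open>4\<close>
  are kept for the quantifiers in the next two formulas, and \<open>rel_fm\<close> takes its arguments from
  \<open>4\<close> on.\<close>

definition pair_fm :: "nat \<Rightarrow> nat \<Rightarrow> nat \<Rightarrow> fm" where
  "pair_fm p x y = Exi 0 (Exi 1 (Conj
     (All 2 (Iff (Mem 2 0) (Eq 2 x))) (Conj
     (All 2 (Iff (Mem 2 1) (Disj (Eq 2 x) (Eq 2 y))))
     (All 2 (Iff (Mem 2 p) (Disj (Eq 2 0) (Eq 2 1)))))))"

definition rel_fm :: "nat \<Rightarrow> nat \<Rightarrow> nat \<Rightarrow> fm" where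
  "rel_fm r x y = Exi 3 (Conj (Mem 3 r) (pair_fm 3 x y))"

lemma sat_pair_fm [simp]:
  assumes "3 \<le> p" "3 \<le> x" "3 \<le> y"
  shows "sat m \<rho> (pair_fm p x y) \<longleftrightarrow> is_pair m (\<rho> p) (\<rho> x) (\<rho> y)"
  using assms unfolding pair_fm_def is_pair_def ext_def by (simp add: set_eq_iff)

lemma sat_rel_fm [simp]:
  assumes "4 \<le> r" "4 \<le> x" "4 \<le> y"
  shows "sat m \<rho> (rel_fm r x y) \<longleftrightarrow> (\<rho> x, \<rho> y) \<in> rel m (\<rho> r)"
  using assms unfolding rel_fm_def rel_def ext_def by simp


section \<open>Jumps\<close>

text \<open>The values of \<open>f\<close> are described through its graph, and not by \<^const>\<open>fun_app\<close>, so that the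
  same first-order formula defines jumps in the standard and in the internal universe.\<close>

definition jump :: "('u \<Rightarrow> 'u \<Rightarrow> bool) \<Rightarrow> 'u \<Rightarrow> 'u \<Rightarrow> 'u \<Rightarrow> 'u \<Rightarrow> 'u \<Rightarrow> bool" where
  "jump m X f v b p \<longleftrightarrow>
     (\<exists>x y x' y'. is_pair m p x y \<and> x \<in> ext m X - ext m b \<and> y \<in> ext m X - ext m b \<and>
        (x, x') \<in> rel m f \<and> (y, y') \<in> rel m f \<and> (x', y') \<notin> rel m v)"

definition jump_fm :: fm where
  "jump_fm = Exi 10 (Exi 11 (Exi 12 (Exi 13
     (Conj (pair_fm 8 10 11)
     (Conj (Conj (Mem 10 4) (Neg (Mem 10 7)))
     (Conj (Conj (Mem 11 4) (Neg (Mem 11 7)))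
     (Conj (rel_fm 5 10 12) (Conj (rel_fm 5 11 13) (Neg (rel_fm 6 12 13))))))))))"

lemma sat_jump_fm [simp]:
  "sat m \<rho> jump_fm \<longleftrightarrow> jump m (\<rho> 4) (\<rho> 5) (\<rho> 6) (\<rho> 7) (\<rho> 8)"
  unfolding jump_fm_def jump_def by (simp add: ext_def)

lemma jump_iff:
  assumes "\<And>x. x \<in> ext m X \<Longrightarrow> \<exists>!y. (x, y) \<in> rel m f" "is_pair m p x y"
  shows "jump m X f v b p \<longleftrightarrow>
    x \<in> ext m X - ext m b \<and> y \<in> ext m X - ext m b \<and> (fun_app m f x, fun_app m f y) \<notin> rel m v"
    (is "_ \<longleftrightarrow> ?R")
proof
  assume "jump m X f v b p"
  then obtain x' y' where "x \<in> ext m X - ext m b" "y \<in> ext m X - ext m b"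
      "(x, x') \<in> rel m f" "(y, y') \<in> rel m f" "(x', y') \<notin> rel m v"
    using is_pair_inj[OF assms(2)] unfolding jump_def by blast
  then show ?R using fun_app_eq_iff[OF assms(1)] by auto
next
  assume R: ?R
  then have "(x, fun_app m f x) \<in> rel m f" "(y, fun_app m f y) \<in> rel m f"
    using fun_app_eq_iff[OF assms(1)] by blast+
  then show "jump m X f v b p"
    using R assms(2) unfolding jump_def by blast
qed


section \<open>Transfer and saturation\<close>

definition bounded_codes :: "('u \<Rightarrow> 'u \<Rightarrow> bool) \<Rightarrow> 'u \<Rightarrow> 'u \<Rightarrow> 'u set" where
  "bounded_codes m X C = {b. ext m b \<in> bounded_sets (ext m X) (rels m C)}"

text \<open>A bounded \<open>B\<close> is the domain of \<open>\<Delta> \<inter> (B \<times> B)\<close>, and \<open>B \<times> B\<close> is a relation coded in the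
  universe; so separation provides a code of \<open>B\<close>.\<close>

lemma (in transitive_universe) bounded_set_code:
  assumes "B \<in> bounded_sets (ext mem X) (rels mem C)"
  obtains b where "b \<in> bounded_codes mem X C" "ext mem b = B"
proof -
  obtain e where e: "B \<times> B = rel mem e" and "B \<subseteq> ext mem X"
    using assms unfolding bounded_sets_def rels_def by auto
  \<comment> \<open>the default value of the assignment gives the parameter \<open>e\<close> to variable \<open>5\<close>\<close>
  obtain b where "ext mem b = {x \<in> ext mem X. sat mem ((\<lambda>_. e)(4 := x)) (rel_fm 5 4 4)}"
    using separation by blast
  then have "ext mem b = {x \<in> ext mem X. (x, x) \<in> B \<times> B}"
    by (simp add: e)
  then have "ext mem b = B" using \<open>B \<subseteq> ext mem X\<close> by auto
  then show ?thesis using that assms unfolding bounded_codes_def by simp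
qed

context saturated_enlargement
begin

lemma transfer_mem: "mem a b \<longleftrightarrow> imem (star a) (star b)"
  using transfer[of "(\<lambda>_. b)(0 := a)" "Mem 0 1"] by simp

lemma transfer_nonempty: "ext mem a \<noteq> {} \<longleftrightarrow> ext imem (star a) \<noteq> {}"
  using transfer[of "\<lambda>_. a" "Exi 0 (Mem 0 1)"] by (simp add: ext_def)

lemma transfer_function:
  assumes "\<And>x. x \<in> ext mem X \<Longrightarrow> \<exists>!y. (x, y) \<in> rel mem f" "x \<in> ext imem (star X)"
  shows "\<exists>!y. (x, y) \<in> rel imem (star f)"
proof -
  let ?\<psi> = "All 6 (Neg (Conj (Mem 6 4)
     (Neg (Exi 7 (All 8 (Iff (rel_fm 5 6 8) (Eq 8 7)))))))"
  let ?\<rho> = "(\<lambda>_. X)(5 := f)"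
  have "\<exists>y. \<forall>z. (x, z) \<in> rel mem f \<longleftrightarrow> z = y" if "x \<in> ext mem X" for x
    using assms(1)[OF that] by blast
  then have "sat mem ?\<rho> ?\<psi>" by (simp add: ext_def)
  then have "sat imem (\<lambda>i. star (?\<rho> i)) ?\<psi>" using transfer by blast
  then have "\<exists>y. \<forall>z. (x, z) \<in> rel imem (star f) \<longleftrightarrow> z = y"
    using assms(2) by (simp add: ext_def)
  then show ?thesis by metis
qed

text \<open>The jumps in \<open>e\<close> off \<open>b\<close> form a set of the universe, whose extension consists of the
  jumps in \<open>*e\<close> off \<open>*b\<close>.\<close>

lemma jump_set:
  obtains d where "ext mem d = {p \<in> ext mem e. jump mem X f v b p}"
    and "ext imem (star d) =
      {p \<in> ext imem (star e). jump imem (star X) (star f) (star v) (star b) p}"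
proof -
  \<comment> \<open>Variable \<open>14\<close> lies beyond the variables bound in \<^const>\<open>jump_fm\<close>; variable \<open>9\<close> keeps the
    default value \<open>e\<close>.\<close>
  let ?\<rho> = "\<lambda>d. (\<lambda>_. e)(4 := X, 5 := f, 6 := v, 7 := b, 14 := d)"
  obtain d where d: "ext mem d = {p \<in> ext mem e. sat mem ((?\<rho> e)(8 := p)) jump_fm}"
    using separation by blast
  let ?\<psi> = "All 8 (Iff (Mem 8 14) (Conj (Mem 8 9) jump_fm))"
  have "sat mem (?\<rho> d) ?\<psi>" using d by (simp add: ext_def set_eq_iff)
  then have "sat imem (\<lambda>i. star (?\<rho> d i)) ?\<psi>" using transfer by blast
  then show thesis using d by (intro that[of d]) (auto simp: ext_def)
qed

text \<open>As there are at most \<open>|\<bbbU>|\<close> standard sets, saturation applies to the extensions of any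
  family of them; a common element \<open>p\<close> of finitely many standard sets gives the common
  element \<open>*p\<close> of their extensions.\<close>

lemma enlargement:
  assumes "\<And>F. finite F \<Longrightarrow> F \<subseteq> D \<Longrightarrow> (\<Inter>d\<in>F. ext mem d) \<noteq> {}"
  shows "(\<Inter>d\<in>D. ext imem (star d)) \<noteq> {}"
proof -
  have "|star ` D| \<le>o |UNIV :: 'u set|"
    using ordLeq_transitive[OF card_of_image card_of_mono1[OF subset_UNIV]] .
  then have "|star ` D| <o cardSuc |UNIV :: 'u set|"
    by (simp add: cardSuc_ordLeq_ordLess card_of_Card_order)
  moreover have "(\<Inter>a\<in>F. ext imem a) \<noteq> {}" if F: "finite F" "F \<subseteq> star ` D" for F
  proof -
    obtain G where G: "G \<subseteq> D" "finite G" "F = star ` G"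
      using F finite_subset_image by metis
    obtain p where "p \<in> (\<Inter>d\<in>G. ext mem d)" using assms[OF G(2,1)] by auto
    then have "star p \<in> (\<Inter>a\<in>F. ext imem a)"
      using G(3) transfer_mem by (simp add: ext_def)
    then show ?thesis by (metis empty_iff)
  qed
  ultimately have "(\<Inter>a\<in>star ` D. ext imem a) \<noteq> {}" by (rule saturation)
  then show ?thesis by simp
qed

text \<open>The galaxies of the points of \<open>X\<close> cover the extension of each bounded set, since a bounded
  set with a nonempty extension has a standard point.\<close>

lemma INF_points_iff:
  "x \<in> INF_points mem imem star X C \<longleftrightarrow>
     x \<in> ext imem (star X) \<and> (\<forall>b\<in>bounded_codes mem X C. x \<notin> ext imem (star b))"
proof -
  have standard_point: "\<exists>x0\<in>ext mem X. x0 \<in> ext mem b"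
    if "b \<in> bounded_codes mem X C" "x \<in> ext imem (star b)" for b
    using that transfer_nonempty[of b] unfolding bounded_codes_def bounded_sets_def by blast
  have "(\<exists>x0\<in>ext mem X. x \<in> galaxy mem imem star X C x0) \<longleftrightarrow>
      (\<exists>b\<in>bounded_codes mem X C. x \<in> ext imem (star b))" (is "?L \<longleftrightarrow> ?R")
  proof
    assume ?L
    then show ?R unfolding galaxy_def bounded_codes_def by auto
  next
    assume ?R
    then obtain b where b: "b \<in> bounded_codes mem X C" "x \<in> ext imem (star b)" by blast
    then obtain x0 where "x0 \<in> ext mem X" "x0 \<in> ext mem b" using standard_point by blast
    then show ?L using b unfolding galaxy_def bounded_codes_def by auto
  qed
  then show ?thesis unfolding INF_points_def by blast
qed

text \<open>This is where the two quantifiers are interchanged.  A jump off a larger set is a jump off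
  each of its subsets, so a jump off a finite union of bounded sets is common to all of them.\<close>

lemma universal_jump_iff:
  assumes "connected_coarse_space mem X C"
  shows "(\<exists>p\<in>ext imem (star e). \<forall>b\<in>bounded_codes mem X C.
            jump imem (star X) (star f) (star v) (star b) p) \<longleftrightarrow>
    (\<forall>b\<in>bounded_codes mem X C. \<exists>p\<in>ext mem e. jump mem X f v b p)"
    (is "?L \<longleftrightarrow> ?R")
proof
  assume ?L
  show ?R
  proof
    fix b
    assume "b \<in> bounded_codes mem X C"
    obtain d where "ext mem d = {p \<in> ext mem e. jump mem X f v b p}"
      "ext imem (star d) =
        {p \<in> ext imem (star e). jump imem (star X) (star f) (star v) (star b) p}"
      by (rule jump_set)
    then show "\<exists>p\<in>ext mem e. jump mem X f v b p"
      using \<open>?L\<close> \<open>b \<in> _\<close> transfer_nonempty[of d] by auto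
  qed
next
  assume R: ?R
  have coarse: "coarse_structure (ext mem X) (rels mem C)" "coarsely_connected (ext mem X) (rels mem C)"
    using assms unfolding connected_coarse_space_def by blast+
  have "\<exists>d. ext mem d = {p \<in> ext mem e. jump mem X f v b p} \<and>
      ext imem (star d) =
        {p \<in> ext imem (star e). jump imem (star X) (star f) (star v) (star b) p}" for b
    by (rule jump_set[of e X f v b]) (intro exI conjI)
  then obtain d where d: "\<And>b. ext mem (d b) = {p \<in> ext mem e. jump mem X f v b p}"
    and star_d: "\<And>b. ext imem (star (d b)) =
        {p \<in> ext imem (star e). jump imem (star X) (star f) (star v) (star b) p}"
    by metis
  have common_jump: "\<exists>p\<in>ext mem e. \<forall>b\<in>G. jump mem X f v b p"
    if G: "finite G" "G \<subseteq> bounded_codes mem X C" for G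
  proof -
    have "(\<Union>b\<in>G. ext mem b) \<in> bounded_sets (ext mem X) (rels mem C)"
      using G by (intro bounded_Union coarse) (auto simp: bounded_codes_def)
    then obtain c where "c \<in> bounded_codes mem X C" and c: "ext mem c = (\<Union>b\<in>G. ext mem b)"
      by (rule bounded_set_code)
    then obtain p where p: "p \<in> ext mem e" "jump mem X f v c p" using R by blast
    have "jump mem X f v b p" if "b \<in> G" for b
    proof -
      have "ext mem b \<subseteq> ext mem c" using c that by blast
      then show ?thesis using p(2) unfolding jump_def by blast
    qed
    then show ?thesis using p by blast
  qed
  have "(\<Inter>a\<in>F. ext mem a) \<noteq> {}"
    if F: "finite F" "F \<subseteq> d ` bounded_codes mem X C" for F
  proof -
    obtain G where G: "G \<subseteq> bounded_codes mem X C" "finite G" "F = d ` G"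
      using F finite_subset_image by metis
    then obtain p where "p \<in> ext mem e" "\<forall>b\<in>G. jump mem X f v b p"
      using common_jump by blast
    then have "p \<in> (\<Inter>a\<in>F. ext mem a)" using d G(3) by simp
    then show ?thesis by (metis empty_iff)
  qed
  then have "(\<Inter>a\<in>d ` bounded_codes mem X C. ext imem (star a)) \<noteq> {}"
    by (rule enlargement)
  then obtain p where "\<forall>b\<in>bounded_codes mem X C. p \<in> ext imem (star (d b))" by auto
  \<comment> \<open>That \<open>p\<close> lies in \<open>*e\<close> is read off from any one of these memberships, so one bounded set
    is required; the empty set will do.\<close>
  moreover obtain b where "b \<in> bounded_codes mem X C"
    using bounded_set_code bounded_Union[OF coarse finite.emptyI] by (metis empty_subsetI)
  ultimately show ?L unfolding star_d by blast
qed

text \<open>A pair determines its components, so an element of \<open>*e\<close> that is a jump off all the \<open>*b\<close> has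
  the same two ends for every \<open>b\<close>; these ends avoid all the \<open>*b\<close> and are thus infinite.\<close>

lemma close_values_iff_no_universal_jump:
  assumes "\<And>x. x \<in> ext mem X \<Longrightarrow> \<exists>!y. (x, y) \<in> rel mem f"
    and ne: "bounded_codes mem X C \<noteq> {}"
  shows "(\<forall>x\<in>INF_points mem imem star X C. \<forall>y\<in>INF_points mem imem star X C.
      (x, y) \<in> rel imem (star e) \<longrightarrow>
      (fun_app imem (star f) x, fun_app imem (star f) y) \<in> rel imem (star v)) \<longleftrightarrow>
    \<not> (\<exists>p\<in>ext imem (star e). \<forall>b\<in>bounded_codes mem X C.
        jump imem (star X) (star f) (star v) (star b) p)"
    (is "?L \<longleftrightarrow> \<not> ?R")
proof -
  let ?jump = "jump imem (star X) (star f) (star v)"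
  have star_f: "\<exists>!y. (x, y) \<in> rel imem (star f)" if "x \<in> ext imem (star X)" for x
    using transfer_function assms(1) that by blast
  have infinite: "x \<in> INF_points mem imem star X C \<and> y \<in> INF_points mem imem star X C \<and>
        (fun_app imem (star f) x, fun_app imem (star f) y) \<notin> rel imem (star v) \<longleftrightarrow>
      (\<forall>b\<in>bounded_codes mem X C. ?jump (star b) p)" if "is_pair imem p x y" for p x y
    using ne by (auto simp: jump_iff[OF star_f that] INF_points_iff)
  have "\<not> ?L \<longleftrightarrow> (\<exists>p\<in>ext imem (star e). \<exists>x y. is_pair imem p x y \<and>
      x \<in> INF_points mem imem star X C \<and> y \<in> INF_points mem imem star X C \<and>
      (fun_app imem (star f) x, fun_app imem (star f) y) \<notin> rel imem (star v))"
    unfolding rel_def[of imem "star e"] by blast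
  also have "\<dots> \<longleftrightarrow> (\<exists>p\<in>ext imem (star e). \<exists>x y. is_pair imem p x y \<and>
      (\<forall>b\<in>bounded_codes mem X C. ?jump (star b) p))"
    by (simp add: infinite cong: conj_cong)
  also have "\<dots> \<longleftrightarrow> ?R"
  proof -
    have "\<exists>x y. is_pair imem p x y" if "?jump b p" for b p
      using that unfolding jump_def by blast
    then show ?thesis using ne by blast
  qed
  finally show ?thesis by blast
qed

end


section \<open>The nonstandard characterization\<close>

text \<open>Besides passing to pairs with both ends outside the bounded set, this replaces the bounded
  sets and the pairs of points by elements of the universe, to which transfer applies.\<close>

lemma (in transitive_universe) slowly_oscillating_iff_no_jump:
  assumes X: "connected_coarse_space mem X C"
    and f: "\<And>x. x \<in> ext mem X \<Longrightarrow> \<exists>!y. (x, y) \<in> rel mem f"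
  shows "slowly_oscillating (ext mem X) (rels mem C) (rels mem V) (fun_app mem f) \<longleftrightarrow>
    (\<forall>e\<in>ext mem C. \<forall>v\<in>ext mem V. \<exists>b\<in>bounded_codes mem X C. \<forall>p\<in>ext mem e. \<not> jump mem X f v b p)"
proof -
  have coarse: "coarse_structure (ext mem X) (rels mem C)"
    using X unfolding connected_coarse_space_def by blast
  have jump: "jump mem X f v b p \<longleftrightarrow> x \<in> ext mem X - ext mem b \<and> y \<in> ext mem X - ext mem b \<and>
      (fun_app mem f x, fun_app mem f y) \<notin> rel mem v" if "is_pair mem p x y" for p x y v b
    using f that by (rule jump_iff)
  have "(\<exists>B\<in>bounded_sets (ext mem X) (rels mem C).
        \<forall>(x, y)\<in>rel mem e - B \<times> B. (fun_app mem f x, fun_app mem f y) \<in> rel mem v) \<longleftrightarrow>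
      (\<exists>b\<in>bounded_codes mem X C. \<forall>p\<in>ext mem e. \<not> jump mem X f v b p)"
    (is "?L \<longleftrightarrow> ?R") if e: "e \<in> ext mem C" for e v
  proof -
    have E: "rel mem e \<in> rels mem C" using e unfolding rels_def by blast
    then have sub: "rel mem e \<subseteq> ext mem X \<times> ext mem X"
      by (rule coarse_structureD(2)[OF coarse])
    have pair: "\<exists>x y. is_pair mem p x y" if "p \<in> ext mem e" for p
      using X e that unfolding connected_coarse_space_def is_rel_def by blast
    have no_jump: "(\<forall>(x, y)\<in>rel mem e. x \<notin> ext mem b \<longrightarrow> y \<notin> ext mem b \<longrightarrow>
          (fun_app mem f x, fun_app mem f y) \<in> rel mem v) \<longleftrightarrow>
        (\<forall>p\<in>ext mem e. \<not> jump mem X f v b p)" (is "?P \<longleftrightarrow> ?Q") for b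
    proof
      assume P: ?P
      show ?Q
      proof
        fix p
        assume p: "p \<in> ext mem e"
        then obtain x y where xy: "is_pair mem p x y" using pair by blast
        then have "(x, y) \<in> rel mem e" using p unfolding rel_def by blast
        then show "\<not> jump mem X f v b p" using P jump[OF xy] by blast
      qed
    next
      assume Q: ?Q
      show ?P
      proof (intro ballI, clarify)
        fix x y
        assume xy: "(x, y) \<in> rel mem e" "x \<notin> ext mem b" "y \<notin> ext mem b"
        then obtain p where p: "p \<in> ext mem e" "is_pair mem p x y" unfolding rel_def by blast
        show "(fun_app mem f x, fun_app mem f y) \<in> rel mem v"
          using Q p(1) jump[OF p(2)] xy sub by blast
      qed
    qed
    have "?L \<longleftrightarrow> (\<exists>B\<in>bounded_sets (ext mem X) (rels mem C). \<forall>(x, y)\<in>rel mem e.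
        x \<notin> B \<longrightarrow> y \<notin> B \<longrightarrow> (fun_app mem f x, fun_app mem f y) \<in> rel mem v)"
      by (rule avoid_square_iff_avoid_ends[OF coarse E])
    also have "\<dots> \<longleftrightarrow> (\<exists>b\<in>bounded_codes mem X C. \<forall>(x, y)\<in>rel mem e.
        x \<notin> ext mem b \<longrightarrow> y \<notin> ext mem b \<longrightarrow> (fun_app mem f x, fun_app mem f y) \<in> rel mem v)"
      (is "(\<exists>B\<in>_. ?S B) \<longleftrightarrow> (\<exists>b\<in>_. ?S (ext mem b))")
    proof
      assume "\<exists>B\<in>bounded_sets (ext mem X) (rels mem C). ?S B"
      then obtain B where B: "B \<in> bounded_sets (ext mem X) (rels mem C)" "?S B" by blast
      obtain b where "b \<in> bounded_codes mem X C" "ext mem b = B"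
        by (rule bounded_set_code[OF B(1)])
      then show "\<exists>b\<in>bounded_codes mem X C. ?S (ext mem b)" using B(2) by blast
    next
      assume "\<exists>b\<in>bounded_codes mem X C. ?S (ext mem b)"
      then show "\<exists>B\<in>bounded_sets (ext mem X) (rels mem C). ?S B"
        unfolding bounded_codes_def by blast
    qed
    also have "\<dots> \<longleftrightarrow> ?R" by (simp only: no_jump)
    finally show ?thesis .
  qed
  then show ?thesis
    unfolding slowly_oscillating_def rels_def[of mem C] rels_def[of mem V] by auto
qed

theorem theorem3p32:
  fixes mem :: "'u \<Rightarrow> 'u \<Rightarrow> bool"
    and imem :: "'s \<Rightarrow> 's \<Rightarrow> bool"
    and star :: "'u \<Rightarrow> 's"
    and X C Y V f :: 'u
  assumes "saturated_enlargement mem imem star"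
    and "connected_coarse_space mem X C"
    and "is_uniform_space mem Y V"
    and "is_fun mem f X Y"
  shows "slowly_oscillating (ext mem X) (rels mem C) (rels mem V) (fun_app mem f) \<longleftrightarrow>
    (\<forall>x\<in>INF_points mem imem star X C. \<forall>y\<in>INF_points mem imem star X C.
       (x, y) \<in> finitely_close mem imem star C \<longrightarrow>
       (fun_app imem (star f) x, fun_app imem (star f) y) \<in> infinitely_close mem imem star V)"
proof -
  let ?SO = "slowly_oscillating (ext mem X) (rels mem C) (rels mem V) (fun_app mem f)"
  let ?INF = "INF_points mem imem star X C"
  interpret saturated_enlargement mem imem star by fact
  have f: "\<And>x. x \<in> ext mem X \<Longrightarrow> \<exists>!y. (x, y) \<in> rel mem f"
    using assms(4) unfolding is_fun_def by blast
  have "{} \<in> bounded_sets (ext mem X) (rels mem C)"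
    using assms(2) unfolding connected_coarse_space_def coarsely_connected_def by simp
  then have ne: "bounded_codes mem X C \<noteq> {}" by (rule bounded_set_code) blast
  have "?SO \<longleftrightarrow> (\<forall>e\<in>ext mem C. \<forall>v\<in>ext mem V.
      \<not> (\<forall>b\<in>bounded_codes mem X C. \<exists>p\<in>ext mem e. jump mem X f v b p))"
    using slowly_oscillating_iff_no_jump[OF assms(2) f] by simp
  also have "\<dots> \<longleftrightarrow> (\<forall>e\<in>ext mem C. \<forall>v\<in>ext mem V. \<forall>x\<in>?INF. \<forall>y\<in>?INF.
      (x, y) \<in> rel imem (star e) \<longrightarrow>
      (fun_app imem (star f) x, fun_app imem (star f) y) \<in> rel imem (star v))"
    by (simp only: universal_jump_iff[OF assms(2), symmetric]
        close_values_iff_no_universal_jump[OF f ne])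
  also have "\<dots> \<longleftrightarrow> (\<forall>x\<in>?INF. \<forall>y\<in>?INF. (x, y) \<in> finitely_close mem imem star C \<longrightarrow>
      (fun_app imem (star f) x, fun_app imem (star f) y) \<in> infinitely_close mem imem star V)"
    unfolding finitely_close_def infinitely_close_def by blast
  finally show ?thesis .
qed

end
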